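(* Let $p,q$ be primes with $q>p+1$ and let $A$ be a (left) brace of order $p^2q$. Let $A_p$ and $A_q$ denote the $p$-primary and $q$-primary components of the additive group of $A$. Then $A$ is a semidirect product $A_p\ltimes A_q$; that is, there is an $A_p$-module structure on the abelian group $A_q$ such that $A$ is isomorphic, as a brace, to the (external) semidirect product $A_p\ltimes A_q$.
   Context: A (left) brace is a (here finite) abelian group $(A,+)$ with a binary operation $\cdot$ such that for all $a,b,c\in A$: (B1) $a\cdot(b+c)=a\cdot b+a\cdot c$; (B2) $(a\cdot b+a+b)\cdot c=a\cdot(b\cdot c)+a\cdot c+b\cdot c$; (B3) the map $x\mapsto a\cdot x+x$ is bijective. Homomorphisms of braces preserve $+$ and $\cdot$. A left ideal of $A$ is an additive subgroup $B$ with $a\cdot B\subseteq B$ for all $a\in A$. The primary components $A_p,A_q$ of $(A,+)$ are left ideals, hence braces under the restricted operations. If $B$ is a brace and $C$ an abelian group, a binary operation $B\times C\to C$, $(b,c)\mapsto b\cdot c$, makes $C$ a $B$-module if for all $a,b\in B$, $x,y\in C$: $0\cdot x=0$; $a\cdot(x+y)=a\cdot x+a\cdot y$; $(a+b+a\cdot b)\cdot x=a\cdot x+b\cdot x+a\cdot(b\cdot x)$. The (external) semidirect product $B\ltimes C$ is the abelian group $B\oplus C$ with multiplication $(b_1,c_1)\cdot(b_2,c_2)=(b_1\cdot b_2,\;b_1\cdot c_2)$, which is a brace. *)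

theory Defs
  imports "HOL-Algebra.Algebra" "HOL-Computational_Algebra.Factorial_Ring"
begin

text \<open>
  A brace lives on the library's ring record: \<open>\<oplus>\<close> and \<open>\<zero>\<close> are the additive group and \<open>\<otimes>\<close> is
  the brace multiplication. The field \<open>\<one>\<close> of the record plays no role here: no axiom
  mentions it and homomorphisms need not preserve it. In the same way, an abelian group
  is a record satisfying \<^locale>\<open>abelian_group\<close>, whose multiplication is ignored.
\<close>

locale brace = abelian_group A for A (structure) +
  assumes mult_closed:
      "\<lbrakk>a \<in> carrier A; b \<in> carrier A\<rbrakk> \<Longrightarrow> a \<otimes> b \<in> carrier A"
    and left_distrib:
      "\<lbrakk>a \<in> carrier A; b \<in> carrier A; c \<in> carrier A\<rbrakk>
        \<Longrightarrow> a \<otimes> (b \<oplus> c) = a \<otimes> b \<oplus> a \<otimes> c"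
    and circle_mult:
      "\<lbrakk>a \<in> carrier A; b \<in> carrier A; c \<in> carrier A\<rbrakk>
        \<Longrightarrow> (a \<otimes> b \<oplus> a \<oplus> b) \<otimes> c = a \<otimes> (b \<otimes> c) \<oplus> a \<otimes> c \<oplus> b \<otimes> c"
    and bij_mult_add:
      "a \<in> carrier A \<Longrightarrow> bij_betw (\<lambda>x. a \<otimes> x \<oplus> x) (carrier A) (carrier A)"

text \<open>
  On the record itself, \<^const>\<open>hom\<close> refers to the brace multiplication \<open>\<otimes>\<close>.
\<close>

definition brace_hom :: "('a, 'm) ring_scheme \<Rightarrow> ('b, 'n) ring_scheme \<Rightarrow> ('a \<Rightarrow> 'b) set"
  where "brace_hom A B = hom (add_monoid A) (add_monoid B) \<inter> hom A B"

definition brace_iso :: "('a, 'm) ring_scheme \<Rightarrow> ('b, 'n) ring_scheme \<Rightarrow> ('a \<Rightarrow> 'b) set"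
  where "brace_iso A B = {h \<in> brace_hom A B. bij_betw h (carrier A) (carrier B)}"

definition isomorphic_braces :: "('a, 'm) ring_scheme \<Rightarrow> ('b, 'n) ring_scheme \<Rightarrow> bool"
  where "isomorphic_braces A B \<longleftrightarrow> brace_iso A B \<noteq> {}"

locale brace_module = B?: brace B + C?: abelian_group C
  for B (structure) and C (structure) +
  fixes act :: "'a \<Rightarrow> 'c \<Rightarrow> 'c" (infixr \<open>\<bullet>\<close> 75)
  assumes act_closed:
      "\<lbrakk>b \<in> carrier B; x \<in> carrier C\<rbrakk> \<Longrightarrow> b \<bullet> x \<in> carrier C"
    and zero_act:
      "x \<in> carrier C \<Longrightarrow> \<zero>\<^bsub>B\<^esub> \<bullet> x = \<zero>\<^bsub>C\<^esub>"
    and act_add: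
      "\<lbrakk>a \<in> carrier B; x \<in> carrier C; y \<in> carrier C\<rbrakk>
        \<Longrightarrow> a \<bullet> (x \<oplus>\<^bsub>C\<^esub> y) = (a \<bullet> x) \<oplus>\<^bsub>C\<^esub> (a \<bullet> y)"
    and circle_act:
      "\<lbrakk>a \<in> carrier B; b \<in> carrier B; x \<in> carrier C\<rbrakk>
        \<Longrightarrow> (a \<oplus>\<^bsub>B\<^esub> b \<oplus>\<^bsub>B\<^esub> a \<otimes>\<^bsub>B\<^esub> b) \<bullet> x
            = (a \<bullet> x) \<oplus>\<^bsub>C\<^esub> (b \<bullet> x) \<oplus>\<^bsub>C\<^esub> (a \<bullet> (b \<bullet> x))"

text \<open>
  The additive group is that of the direct product; only the multiplication is replaced.
\<close>

definition semidirect_product ::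
    "('a, 'm) ring_scheme \<Rightarrow> ('c, 'n) ring_scheme \<Rightarrow> ('a \<Rightarrow> 'c \<Rightarrow> 'c) \<Rightarrow> ('a \<times> 'c) ring"
  where "semidirect_product B C act =
    (RDirProd B C)\<lparr>mult := (\<lambda>(b1, c1) (b2, c2). (b1 \<otimes>\<^bsub>B\<^esub> b2, act b1 c2))\<rparr>"

text \<open>
  The operations on the primary component are the restricted ones, so only the carrier changes.
\<close>

definition primary_component :: "('a, 'm) ring_scheme \<Rightarrow> nat \<Rightarrow> ('a, 'm) ring_scheme"
  where "primary_component A p =
    A\<lparr>carrier := {x \<in> carrier A. \<exists>k::nat. [(p ^ k)] \<cdot>\<^bsub>A\<^esub> x = \<zero>\<^bsub>A\<^esub>}\<rparr>"

end

theory Submission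
  imports Defs
begin

text \<open>
  For \<open>a\<close> in the brace put \<open>\<lambda>\<^sub>a x = a \<cdot> x + x\<close>. This defines an action of the circle group
  \<open>a \<circ> b = a \<cdot> b + a + b\<close> by additive automorphisms, and it preserves \<open>A\<^sub>p\<close> and \<open>A\<^sub>q\<close>.
  If \<open>c \<in> A\<^sub>q\<close>, then \<open>\<lambda>\<^sub>c\<close> has order dividing \<open>q\<close>, so the number of its fixed points on an
  invariant subgroup is congruent modulo \<open>q\<close> to the order of that subgroup. The fixed points
  form a subgroup, and \<open>q\<close> divides none of \<open>q - 1\<close>, \<open>p\<^sup>2 - p\<close>, \<open>p\<^sup>2 - 1\<close> because \<open>q > p + 1\<close>;
  hence \<open>\<lambda>\<^sub>c\<close> is trivial on \<open>A\<^sub>p\<close> and on \<open>A\<^sub>q\<close>. Since \<open>b + c = b \<circ> \<lambda>\<^sub>b\<inverse> c\<close>, it follows that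
  \<open>(b + c) \<cdot> y = b \<cdot> y\<close>, so that addition is an isomorphism from the semidirect product to \<open>A\<close>.
\<close>

section \<open>Permutations of prime period\<close>

text \<open>The powers of \<open>f\<close> act on \<open>S\<close> as a cyclic group of order
  \<open>q\<close>. The non-fixed points split into orbits, and primality of \<open>q\<close> forces
  each of these to have exactly \<open>q\<close> elements.\<close>

lemma prime_period_dvd_card_nonfixed:
  fixes f :: "'a \<Rightarrow> 'a" and q :: nat
  assumes fin: "finite S" and closed: "\<And>x. x \<in> S \<Longrightarrow> f x \<in> S"
    and period: "\<And>x. x \<in> S \<Longrightarrow> (f ^^ q) x = x" and q: "Factorial_Ring.prime q"
  shows "q dvd card {x \<in> S. f x \<noteq> x}"
proof -
  define N where "N = {x \<in> S. f x \<noteq> x}"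
  define r where "r = {(x, y). x \<in> N \<and> y \<in> N \<and> (\<exists>k. y = (f ^^ k) x)}"
  have q0: "q > 0" using q by (simp add: prime_gt_0_nat)
  have closed_pow: "(f ^^ k) x \<in> S" if "x \<in> S" for k x
    using that by (induction k) (auto intro: closed)
  \<comment> \<open>Inverses of powers of \<open>f\<close> are again forward powers, since the
    exponents add up to a multiple of the period. This makes the forward-orbit relation
    \<open>r\<close> symmetric.\<close>
  have return: "(f ^^ ((q - 1) * k)) ((f ^^ k) x) = x" if "x \<in> S" for k x
  proof -
    have "(q - 1) * k + k = q * k" using q0 by (cases q) auto
    then have "(f ^^ ((q - 1) * k)) ((f ^^ k) x) = (f ^^ (q * k)) x"
      by (metis comp_apply funpow_add)
    also have "\<dots> = (f ^^ ((q * k) mod q)) x"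
      using funpow_mod_eq[OF period[OF that]] by metis
    finally show ?thesis by simp
  qed
  \<comment> \<open>If a later point of the orbit were fixed, the power in \<open>return\<close>
    would leave it in place and also carry it back to \<open>x\<close>, so \<open>x\<close> itself
    would be fixed.\<close>
  have N_pow: "(f ^^ k) x \<in> N" if x: "x \<in> N" for k x
  proof -
    have "f ((f ^^ k) x) \<noteq> (f ^^ k) x"
    proof
      assume "f ((f ^^ k) x) = (f ^^ k) x"
      then have "(f ^^ j) ((f ^^ k) x) = (f ^^ k) x" for j
        by (induction j) auto
      with return[of x k] x have "(f ^^ k) x = x" by (simp add: N_def)
      with \<open>f ((f ^^ k) x) = (f ^^ k) x\<close> x show False by (simp add: N_def)
    qed
    with closed_pow x show ?thesis by (simp add: N_def)
  qed
  have equiv: "equiv N r"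
  proof (rule equivI)
    show "r \<subseteq> N \<times> N" by (auto simp: r_def)
    show "refl_on N r"
      by (rule refl_onI) (auto simp: r_def intro: exI[of _ 0])
    show "sym r"
    proof (rule symI)
      fix x y assume "(x, y) \<in> r"
      then obtain k where "x \<in> N" "y \<in> N" "y = (f ^^ k) x" by (auto simp: r_def)
      with return[of x k] have "x = (f ^^ ((q - 1) * k)) y" by (simp add: N_def)
      with \<open>x \<in> N\<close> \<open>y \<in> N\<close> show "(y, x) \<in> r" by (auto simp: r_def)
    qed
    show "trans r"
    proof (rule transI)
      fix x y z assume "(x, y) \<in> r" "(y, z) \<in> r"
      then obtain k l where "x \<in> N" "z \<in> N" "y = (f ^^ k) x" "z = (f ^^ l) y"
        by (auto simp: r_def)
      then have "z = (f ^^ (l + k)) x" by (simp add: funpow_add)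
      with \<open>x \<in> N\<close> \<open>z \<in> N\<close> show "(x, z) \<in> r" by (auto simp: r_def)
    qed
  qed
  have inj: "inj_on (\<lambda>k. (f ^^ k) x) {..<q}" if x: "x \<in> N" for x
  proof -
    have False if ij: "i < j" "j < q" "(f ^^ i) x = (f ^^ j) x" for i j
    proof -
      have xS: "x \<in> S" using x by (simp add: N_def)
      define d where "d = j - i"
      have d: "0 < d" "d < q" using ij by (auto simp: d_def)
      have "(f ^^ ((q - 1) * i)) ((f ^^ i) x) = (f ^^ ((q - 1) * i)) ((f ^^ i) ((f ^^ d) x))"
        using ij by (metis comp_apply d_def funpow_add le_add_diff_inverse less_imp_le)
      then have fd: "(f ^^ d) x = x"
        using return[of x i] return[of "(f ^^ d) x" i] closed_pow[OF xS] xS by simp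
      \<comment> \<open>Bezout combines the periods \<open>d\<close> and \<open>q\<close> of
        \<open>x\<close> into period 1, contradicting that \<open>x\<close> is not fixed.\<close>
      have "coprime d q"
        using d q by (metis coprime_commute nat_dvd_not_less prime_imp_coprime)
      then obtain u v where uv: "d * u = q * v + 1"
        using bezout_nat[of d q] d by auto
      have "(f ^^ (d * u)) x = x"
        using funpow_mod_eq[OF fd, of "d * u"] by simp
      moreover have "(f ^^ (q * v)) x = x"
        using funpow_mod_eq[OF period[OF xS], of "q * v"] by simp
      ultimately have "f x = x" using uv by simp
      with x show False by (simp add: N_def)
    qed
    then show ?thesis
      by (intro inj_onI) (metis lessThan_iff linorder_neqE_nat)
  qed
  have "q dvd card Y" if Y_in: "Y \<in> N // r" for Y
  proof -
    obtain x where Y: "Y = r `` {x}" and x: "x \<in> N"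
      using Y_in by (rule quotientE)
    have period_x: "(f ^^ q) x = x" using x period by (simp add: N_def)
    have "Y = (\<lambda>k. (f ^^ k) x) ` {..<q}"
    proof
      show "Y \<subseteq> (\<lambda>k. (f ^^ k) x) ` {..<q}"
      proof
        fix y assume "y \<in> Y"
        then obtain k where "y = (f ^^ k) x" unfolding Y r_def by blast
        then have "y = (f ^^ (k mod q)) x"
          using funpow_mod_eq[OF period_x, of k] by simp
        then show "y \<in> (\<lambda>k. (f ^^ k) x) ` {..<q}" using q0 by simp
      qed
      show "(\<lambda>k. (f ^^ k) x) ` {..<q} \<subseteq> Y"
      proof (rule image_subsetI)
        fix k
        show "(f ^^ k) x \<in> Y" using x N_pow[OF x, of k] unfolding Y r_def by blast
      qed
    qed
    then show ?thesis using card_image[OF inj[OF x]] by simp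
  qed
  then have "q dvd card N"
    using equiv_imp_dvd_card[of N r q] equiv fin by (simp add: N_def)
  then show ?thesis by (simp add: N_def)
qed

text \<open>The fixed points form a subgroup, so their number divides the group order by Lagrange,
  while \<open>q\<close> divides the number of remaining elements. The hypothesis
  \<open>proper\<close> is the arithmetic that rules out a proper subgroup of this kind.\<close>

lemma (in group) trivial_hom_of_prime_period:
  assumes fin: "finite (carrier G)" and hom: "f \<in> hom G G"
    and period: "\<And>x. x \<in> carrier G \<Longrightarrow> (f ^^ q) x = x" and q: "Factorial_Ring.prime (q :: nat)"
    and proper: "\<And>d. d dvd order G \<Longrightarrow> q dvd order G - d \<Longrightarrow> d = order G"
    and x: "x \<in> carrier G"
  shows "f x = x"
proof -
  define F where "F = {x \<in> carrier G. f x = x}"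
  interpret f: group_hom G G f
    using hom by unfold_locales
  have "subgroup F G"
    by (rule subgroupI) (auto simp: F_def intro: exI[of _ \<one>])
  then have "card F dvd order G"
    using lagrange by (metis dvd_triv_right)
  moreover have "{x \<in> carrier G. f x \<noteq> x} = carrier G - F" by (auto simp: F_def)
  then have "card {x \<in> carrier G. f x \<noteq> x} = order G - card F"
    using fin by (simp add: card_Diff_subset order_def F_def)
  then have "q dvd order G - card F"
    using prime_period_dvd_card_nonfixed[of "carrier G" f q] fin period q by simp
  ultimately have "card F = card (carrier G)"
    using proper by (simp add: order_def)
  then have "F = carrier G"
    using fin by (intro card_subset_eq) (auto simp: F_def)
  with x show ?thesis by (auto simp: F_def)
qed

section \<open>The circle group and its action\<close>

definition circle_group :: "('a, 'm) ring_scheme \<Rightarrow> 'a monoid" where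
  "circle_group A =
    \<lparr>carrier = carrier A, monoid.mult = (\<lambda>a b. a \<otimes>\<^bsub>A\<^esub> b \<oplus>\<^bsub>A\<^esub> a \<oplus>\<^bsub>A\<^esub> b), one = \<zero>\<^bsub>A\<^esub>\<rparr>"

text \<open>This is the map \<open>\<lambda>\<^sub>a\<close> of the overview.\<close>

definition circle_action :: "('a, 'm) ring_scheme \<Rightarrow> 'a \<Rightarrow> 'a \<Rightarrow> 'a" where
  "circle_action A a x = a \<otimes>\<^bsub>A\<^esub> x \<oplus>\<^bsub>A\<^esub> x"

context brace
begin

lemma mult_zero [simp]:
  assumes "a \<in> carrier A" shows "a \<otimes> \<zero> = \<zero>"
proof -
  have "a \<otimes> \<zero> \<oplus> a \<otimes> \<zero> = a \<otimes> \<zero>"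
    using left_distrib[of a \<zero> \<zero>] assms by simp
  then show ?thesis using assms mult_closed by (simp add: add.l_cancel_one)
qed

lemma circle_action_bij:
  "a \<in> carrier A \<Longrightarrow> bij_betw (circle_action A a) (carrier A) (carrier A)"
  using bij_mult_add unfolding circle_action_def by simp

lemma circle_action_closed [simp]:
  "a \<in> carrier A \<Longrightarrow> x \<in> carrier A \<Longrightarrow> circle_action A a x \<in> carrier A"
  by (simp add: circle_action_def mult_closed)

lemma circle_action_add:
  assumes "a \<in> carrier A" "x \<in> carrier A" "y \<in> carrier A"
  shows "circle_action A a (x \<oplus> y) = circle_action A a x \<oplus> circle_action A a y"
  using assms by (simp add: circle_action_def left_distrib mult_closed a_ac)

lemma circle_action_zero [simp]: "a \<in> carrier A \<Longrightarrow> circle_action A a \<zero> = \<zero>"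
  by (simp add: circle_action_def)

text \<open>Axiom (B2) with both left factors zero says, after cancelling, that
  \<open>circle_action A \<zero>\<close> sends \<open>\<zero> \<otimes> c\<close> to zero. It also
  fixes zero and is injective.\<close>

lemma zero_mult [simp]:
  assumes "c \<in> carrier A" shows "\<zero> \<otimes> c = \<zero>"
proof -
  have c: "\<zero> \<otimes> c \<in> carrier A" using assms by (simp add: mult_closed)
  have "\<zero> \<otimes> c \<oplus> \<zero> = \<zero> \<otimes> c \<oplus> circle_action A \<zero> (\<zero> \<otimes> c)"
    using circle_mult[of \<zero> \<zero> c] assms c
    by (simp add: circle_action_def mult_closed a_ac)
  then have "circle_action A \<zero> (\<zero> \<otimes> c) = circle_action A \<zero> \<zero>"
    using c by (simp add: add.l_cancel mult_closed circle_action_def)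
  then show ?thesis
    using bij_betw_imp_inj_on[OF circle_action_bij[of \<zero>]] c inj_onD zero_closed by metis
qed

lemma circle_action_zero_left: "x \<in> carrier A \<Longrightarrow> circle_action A \<zero> x = x"
  by (simp add: circle_action_def)

text \<open>This is (B2) with \<open>x\<close> added to both sides, once the right-hand side is
  expanded by left distributivity.\<close>

lemma circle_action_circle:
  assumes "a \<in> carrier A" "b \<in> carrier A" "x \<in> carrier A"
  shows "circle_action A (a \<otimes> b \<oplus> a \<oplus> b) x = circle_action A a (circle_action A b x)"
  using assms circle_mult[of a b x]
  by (simp add: circle_action_def left_distrib mult_closed a_assoc)

text \<open>The bridge between the two group structures: together with surjectivity of the action it
  yields circle inverses, and later it turns a sum into a circle product.\<close>

lemma circle_eq:
  assumes "a \<in> carrier A" "b \<in> carrier A"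
  shows "a \<otimes> b \<oplus> a \<oplus> b = a \<oplus> circle_action A a b"
  using assms by (simp add: circle_action_def mult_closed a_ac)

text \<open>Associativity comes from (B2). Solving \<open>circle_action A a b = \<ominus> a\<close>
  gives right inverses, whereas \<open>groupI\<close> asks for left ones.\<close>

lemma circle_group: "group (circle_group A)"
proof -
  let ?c = "\<lambda>a b. a \<otimes> b \<oplus> a \<oplus> b"
  have right_inv: "\<exists>b \<in> carrier A. ?c a b = \<zero>" if a: "a \<in> carrier A" for a
  proof -
    obtain b where b: "b \<in> carrier A" "circle_action A a b = \<ominus> a"
      using circle_action_bij[OF a] a unfolding bij_betw_def by (metis a_inv_closed imageE)
    then show ?thesis using a circle_eq[of a b] by (auto simp: r_neg)
  qed
  have assoc: "?c (?c a b) d = ?c a (?c b d)"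
    if "a \<in> carrier A" "b \<in> carrier A" "d \<in> carrier A" for a b d
    using that circle_mult[of a b d] by (simp add: left_distrib mult_closed a_ac)
  have closed: "?c a b \<in> carrier A" if "a \<in> carrier A" "b \<in> carrier A" for a b
    using that by (simp add: mult_closed)
  have left_inv: "\<exists>b \<in> carrier A. ?c b a = \<zero>" if a: "a \<in> carrier A" for a
  proof -
    obtain b where b: "b \<in> carrier A" "?c a b = \<zero>" using right_inv[OF a] by blast
    obtain d where d: "d \<in> carrier A" "?c b d = \<zero>" using right_inv[OF b(1)] by blast
    \<comment> \<open>If \<open>b\<close> is a right inverse of \<open>a\<close> and
      \<open>d\<close> one of \<open>b\<close>, bracketing the triple product in both ways gives
      \<open>a = d\<close>, so \<open>b\<close> is also a left inverse of \<open>a\<close>.\<close>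
    have "a = d" using assoc[OF a b(1) d(1)] a b d by simp
    with b d show ?thesis by auto
  qed
  show ?thesis
    by (rule groupI) (use closed assoc left_inv in \<open>simp_all add: circle_group_def\<close>)
qed

text \<open>Translates the order of an element in the circle group into a period of the permutation
  it induces.\<close>

lemma circle_action_pow:
  assumes "a \<in> carrier A" "x \<in> carrier A"
  shows "circle_action A (a [^]\<^bsub>circle_group A\<^esub> (n :: nat)) x = (circle_action A a ^^ n) x"
proof -
  interpret C: group "circle_group A" by (rule circle_group)
  have pow: "a [^]\<^bsub>circle_group A\<^esub> (k :: nat) \<in> carrier A" for k
    using C.nat_pow_closed[of a k] assms by (simp add: circle_group_def)
  show ?thesis using assms(2)
  proof (induction n arbitrary: x)
    case 0
    then show ?case by (simp add: circle_group_def circle_action_zero_left)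
  next
    case (Suc n)
    have "circle_action A (a [^]\<^bsub>circle_group A\<^esub> Suc n) x
        = circle_action A (a [^]\<^bsub>circle_group A\<^esub> n) (circle_action A a x)"
      using circle_action_circle[OF pow assms(1) Suc.prems, of n]
      by (simp add: circle_group_def)
    then show ?case using Suc assms(1) by (simp add: funpow_swap1)
  qed
qed

section \<open>Primary components\<close>

lemma mult_nat_pow:
  assumes "a \<in> carrier A" "x \<in> carrier A"
  shows "a \<otimes> ([(n::nat)] \<cdot> x) = [n] \<cdot> (a \<otimes> x)"
  using assms by (induction n) (auto simp: left_distrib mult_closed)

lemma carrier_primary_component:
  "carrier (primary_component A p) = {x \<in> carrier A. \<exists>k::nat. [(p ^ k)] \<cdot> x = \<zero>}"
  by (simp add: primary_component_def)

lemma primary_component_simps [simp]: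
  "(\<otimes>\<^bsub>primary_component A p\<^esub>) = (\<otimes>)"
  "(\<oplus>\<^bsub>primary_component A p\<^esub>) = (\<oplus>)"
  "\<zero>\<^bsub>primary_component A p\<^esub> = \<zero>"
  by (simp_all add: primary_component_def)

lemma primary_component_subset: "carrier (primary_component A p) \<subseteq> carrier A"
  by (auto simp: carrier_primary_component)

lemma primary_component_subgroup:
  "subgroup (carrier (primary_component A p)) (add_monoid A)"
proof (rule add.subgroupI)
  show "carrier (primary_component A p) \<subseteq> carrier A"
    by (rule primary_component_subset)
  show "carrier (primary_component A p) \<noteq> {}"
    using add.nat_pow_one by (auto simp: carrier_primary_component)
next
  fix a assume "a \<in> carrier (primary_component A p)"
  then show "\<ominus> a \<in> carrier (primary_component A p)"
    using add.nat_pow_inv by (auto simp: carrier_primary_component)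
next
  fix a b assume "a \<in> carrier (primary_component A p)" "b \<in> carrier (primary_component A p)"
  then obtain k l :: nat where k: "a \<in> carrier A" "[(p ^ k)] \<cdot> a = \<zero>"
    and l: "b \<in> carrier A" "[(p ^ l)] \<cdot> b = \<zero>"
    by (auto simp: carrier_primary_component)
  have "[(p ^ (k + l))] \<cdot> a = \<zero>"
    using add.nat_pow_pow[OF k(1), of "p ^ l" "p ^ k"] k by (simp add: power_add)
  moreover have "[(p ^ (k + l))] \<cdot> b = \<zero>"
    using add.nat_pow_pow[OF l(1), of "p ^ k" "p ^ l"] l by (simp add: power_add mult.commute)
  ultimately have "[(p ^ (k + l))] \<cdot> (a \<oplus> b) = \<zero>"
    using k l by (simp add: add.nat_pow_distrib)
  then show "a \<oplus> b \<in> carrier (primary_component A p)"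
    using k l by (auto simp: carrier_primary_component)
qed

text \<open>With \<open>a\<close> ranging over the whole brace, this makes the component a left
  ideal: a multiple that kills \<open>x\<close> kills \<open>a \<otimes> x\<close>, as left
  multiplication is additive.\<close>

lemma mult_primary_component:
  assumes "a \<in> carrier A" "x \<in> carrier (primary_component A p)"
  shows "a \<otimes> x \<in> carrier (primary_component A p)"
proof -
  obtain k :: nat where k: "x \<in> carrier A" "[(p ^ k)] \<cdot> x = \<zero>"
    using assms by (auto simp: carrier_primary_component)
  then have "[(p ^ k)] \<cdot> (a \<otimes> x) = \<zero>"
    using mult_nat_pow[OF assms(1) k(1), of "p ^ k"] assms by simp
  then show ?thesis
    using assms k by (auto simp: carrier_primary_component mult_closed)
qed

text \<open>For surjectivity, take the preimage \<open>y\<close> of \<open>x\<close> in all of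
  \<open>A\<close>. If \<open>p ^ k\<close> kills \<open>x\<close>, then the action sends the
  \<open>p ^ k\<close>-fold multiple of \<open>y\<close> to zero, and injectivity puts
  \<open>y\<close> into the component.\<close>

lemma circle_action_primary_component_bij:
  fixes p :: nat
  assumes a: "a \<in> carrier A"
  defines "P \<equiv> carrier (primary_component A p)"
  shows "bij_betw (circle_action A a) P P"
proof -
  have sub: "P \<subseteq> carrier A" unfolding P_def by (rule primary_component_subset)
  have inj: "inj_on (circle_action A a) (carrier A)"
    using circle_action_bij[OF a] by (rule bij_betw_imp_inj_on)
  have "circle_action A a x \<in> P" if "x \<in> P" for x
    using that a sub mult_primary_component[OF a, of x p]
      subgroup.m_closed[OF primary_component_subgroup]
    by (auto simp: circle_action_def P_def)
  moreover have "x \<in> circle_action A a ` P" if x: "x \<in> P" for x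
  proof -
    obtain y where y: "y \<in> carrier A" "circle_action A a y = x"
      using circle_action_bij[OF a] x sub unfolding bij_betw_def by (metis imageE subsetD)
    obtain k :: nat where k: "[(p ^ k)] \<cdot> x = \<zero>"
      using x by (auto simp: P_def carrier_primary_component)
    have "circle_action A a ([(p ^ k)] \<cdot> y) = [(p ^ k)] \<cdot> circle_action A a y"
      using a y(1) by (simp add: circle_action_def mult_nat_pow add.nat_pow_distrib mult_closed)
    also have "\<dots> = circle_action A a \<zero>" using a y k by simp
    finally have "[(p ^ k)] \<cdot> y = \<zero>"
      using inj y by (auto dest: inj_onD)
    with y show ?thesis by (auto simp: P_def carrier_primary_component)
  qed
  ultimately have "circle_action A a ` P = P" by blast
  then show ?thesis using inj sub by (auto simp: bij_betw_def intro: inj_on_subset)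
qed

lemma primary_component_brace: "brace (primary_component A p)"
proof -
  let ?P = "primary_component A p"
  interpret P: subgroup "carrier ?P" "add_monoid A" by (rule primary_component_subgroup)
  have sub: "x \<in> carrier A" if "x \<in> carrier ?P" for x
    using that primary_component_subset by blast
  have "abelian_group ?P"
  proof (rule abelian_groupI)
    show "\<exists>y \<in> carrier ?P. y \<oplus>\<^bsub>?P\<^esub> x = \<zero>\<^bsub>?P\<^esub>" if "x \<in> carrier ?P" for x
      using that sub P.m_inv_closed[of x]
      by (intro bexI[of _ "\<ominus> x"]) (auto simp: l_neg a_inv_def)
  qed (use P.m_closed P.one_closed sub in \<open>auto simp: a_ac\<close>)
  moreover have "bij_betw (\<lambda>x. a \<otimes> x \<oplus> x) (carrier ?P) (carrier ?P)" if "a \<in> carrier ?P" for a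
    using circle_action_primary_component_bij[OF sub[OF that]] unfolding circle_action_def .
  ultimately show ?thesis
    by (intro brace.intro brace_axioms.intro)
      (use sub in \<open>auto simp: mult_primary_component left_distrib circle_mult\<close>)
qed

text \<open>Since the second component is a left ideal of the whole brace, the brace multiplication
  restricts to an action on it. The circle axiom is (B2) with the summands reordered.\<close>

lemma primary_component_module:
  "brace_module (primary_component A p) (primary_component A q) (\<otimes>)"
proof -
  have sub: "x \<in> carrier A" if "x \<in> carrier (primary_component A n)" for x n
    using that primary_component_subset by blast
  interpret P: brace "primary_component A p" by (rule primary_component_brace)
  interpret Q: brace "primary_component A q" by (rule primary_component_brace)
  show ?thesis
  proof unfold_locales
    fix a b x
    assume ab: "a \<in> carrier (primary_component A p)" "b \<in> carrier (primary_component A p)"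
      and x: "x \<in> carrier (primary_component A q)"
    have "(a \<oplus> b \<oplus> a \<otimes> b) \<otimes> x = (a \<otimes> b \<oplus> a \<oplus> b) \<otimes> x"
      using ab sub by (simp add: a_ac mult_closed)
    also have "\<dots> = a \<otimes> x \<oplus> b \<otimes> x \<oplus> a \<otimes> (b \<otimes> x)"
      using circle_mult[of a b x] ab x sub by (simp add: a_ac mult_closed)
    finally show "(a \<oplus>\<^bsub>primary_component A p\<^esub> b
        \<oplus>\<^bsub>primary_component A p\<^esub> a \<otimes>\<^bsub>primary_component A p\<^esub> b) \<otimes> x
      = a \<otimes> x \<oplus>\<^bsub>primary_component A q\<^esub> b \<otimes> x \<oplus>\<^bsub>primary_component A q\<^esub> a \<otimes> (b \<otimes> x)"
      by simp
  qed (use sub in \<open>auto simp: mult_primary_component left_distrib\<close>)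
qed

text \<open>By Lagrange in \<open>H\<close>, the order of \<open>x\<close> divides
  \<open>p ^ k\<close>. This places Sylow subgroups inside the primary components.\<close>

lemma primary_component_memI:
  assumes "subgroup H (add_monoid A)" "card H = p ^ k" "x \<in> H"
  shows "x \<in> carrier (primary_component A p)"
proof -
  interpret H: subgroup H "add_monoid A" by (rule assms)
  interpret HG: group "add_monoid A\<lparr>carrier := H\<rparr>"
    by (rule H.subgroup_is_group) (rule add.is_group)
  have "x [^]\<^bsub>add_monoid A\<lparr>carrier := H\<rparr>\<^esub> (p ^ k) = \<zero>"
    using HG.pow_order_eq_1[of x] assms by (simp add: order_def)
  then have "[(p ^ k)] \<cdot> x = \<zero>"
    by (simp add: add_pow_def nat_pow_def)
  then show ?thesis
    using H.subset assms(3) by (auto simp: carrier_primary_component)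
qed

section \<open>Additive splitting for an order with two prime factors\<close>

context
  fixes p q k l :: nat
  assumes p: "Factorial_Ring.prime p" and q: "Factorial_Ring.prime q" and pq: "p \<noteq> q"
    and order: "order A = p ^ k * q ^ l"
begin

text \<open>Both halves rest on Bezout for powers of \<open>p\<close> and \<open>q\<close>: it makes
  the two components meet only in zero, and it writes every element as a sum.\<close>

lemma primary_sum_bij:
  "bij_betw (\<lambda>(b, c). b \<oplus> c)
    (carrier (primary_component A p) \<times> carrier (primary_component A q)) (carrier A)"
proof -
  let ?P = "carrier (primary_component A p)" and ?Q = "carrier (primary_component A q)"
  have sub: "x \<in> carrier A" if "x \<in> carrier (primary_component A n)" for x n
    using that primary_component_subset by blast
  have coprime: "coprime (p ^ i) (q ^ j)" for i j
    using primes_coprime[OF p q pq] by simp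
  interpret P: subgroup ?P "add_monoid A" by (rule primary_component_subgroup)
  interpret Q: subgroup ?Q "add_monoid A" by (rule primary_component_subgroup)
  have int: "x = \<zero>" if xP: "x \<in> ?P" and xQ: "x \<in> ?Q" for x
  proof -
    obtain i j :: nat where ij: "[(p ^ i)] \<cdot> x = \<zero>" "[(q ^ j)] \<cdot> x = \<zero>" and x: "x \<in> carrier A"
      using xP xQ by (auto simp: carrier_primary_component)
    have "p ^ i \<noteq> 0" using p by (simp add: prime_gt_0_nat)
    then obtain u v where uv: "p ^ i * u = q ^ j * v + 1"
      using bezout_nat[of "p ^ i" "q ^ j"] coprime by auto
    have "[(p ^ i * u)] \<cdot> x = \<zero>" "[(q ^ j * v)] \<cdot> x = \<zero>"
      using add.nat_pow_pow[OF x, symmetric] ij by simp_all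
    then show ?thesis using uv x by simp
  qed
  have "inj_on (\<lambda>(b, c). b \<oplus> c) (?P \<times> ?Q)"
  proof (rule inj_onI, clarify)
    fix b c b' c'
    assume mem: "b \<in> ?P" "c \<in> ?Q" "b' \<in> ?P" "c' \<in> ?Q" and eq: "b \<oplus> c = b' \<oplus> c'"
    have A: "b \<in> carrier A" "c \<in> carrier A" "b' \<in> carrier A" "c' \<in> carrier A"
      using mem sub by auto
    have "b \<ominus> b' = c' \<ominus> c"
    proof -
      have "b \<ominus> b' = (b \<oplus> c) \<oplus> (\<ominus> b' \<oplus> \<ominus> c)"
        using A by (simp add: a_minus_def a_ac r_neg1 r_neg2 r_neg l_neg)
      also have "\<dots> = (b' \<oplus> c') \<oplus> (\<ominus> b' \<oplus> \<ominus> c)" using eq by simp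
      also have "\<dots> = (b' \<oplus> \<ominus> b') \<oplus> (c' \<oplus> \<ominus> c)"
        using A by (simp add: a_ac)
      also have "\<dots> = c' \<ominus> c"
        using A by (simp add: a_minus_def r_neg)
      finally show ?thesis .
    qed
    moreover have "b \<ominus> b' \<in> ?P" "c' \<ominus> c \<in> ?Q"
      using mem P.m_closed P.m_inv_closed Q.m_closed Q.m_inv_closed
      by (auto simp: a_minus_def a_inv_def)
    ultimately have "b \<ominus> b' = \<zero>" "c' \<ominus> c = \<zero>" using int by metis+
    then show "b = b' \<and> c = c'" using A by (simp add: add.inv_solve_right' minus_eq)
  qed
  moreover have "x \<in> (\<lambda>(b, c). b \<oplus> c) ` (?P \<times> ?Q)" if x: "x \<in> carrier A" for x
  proof -
    have "p ^ k \<noteq> 0" using p by (simp add: prime_gt_0_nat)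
    then obtain u v where uv: "p ^ k * u = q ^ l * v + 1"
      using bezout_nat[of "p ^ k" "q ^ l"] coprime by auto
    \<comment> \<open>The Bezout identity \<open>uv\<close> gives \<open>x = b \<oplus> c\<close>.
      The roles cross: the multiple of \<open>q ^ l\<close> is killed by \<open>p ^ k\<close> and
      vice versa, because the group order kills \<open>x\<close>.\<close>
    define b c where "b = \<ominus> ([(q ^ l * v)] \<cdot> x)" and "c = [(p ^ k * u)] \<cdot> x"
    have 0: "[(p ^ k * q ^ l * n)] \<cdot> x = \<zero>" for n
      using add.pow_order_eq_1[of x] add.nat_pow_pow[OF x, of n "p ^ k * q ^ l"] order x
      by (simp add: order_def)
    have "[(q ^ l)] \<cdot> c = \<zero>"
      using add.nat_pow_pow[OF x, of "q ^ l" "p ^ k * u"] 0[of u]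
      by (simp add: c_def ac_simps)
    moreover have "c \<in> carrier A" using x by (simp add: c_def)
    ultimately have c: "c \<in> ?Q" by (auto simp only: carrier_primary_component)
    have "[(p ^ k)] \<cdot> ([(q ^ l * v)] \<cdot> x) = \<zero>"
      using add.nat_pow_pow[OF x, of "p ^ k" "q ^ l * v"] 0[of v]
      by (simp add: ac_simps)
    moreover have "[(q ^ l * v)] \<cdot> x \<in> carrier A" using x by simp
    ultimately have "[(q ^ l * v)] \<cdot> x \<in> ?P" by (auto simp only: carrier_primary_component)
    then have b: "b \<in> ?P" using P.m_inv_closed by (simp add: b_def a_inv_def)
    have "x = b \<oplus> c"
      using x uv by (simp add: b_def c_def r_neg1)
    with b c show ?thesis by (intro image_eqI[of _ _ "(b, c)"]) simp_all
  qed
  moreover have "b \<oplus> c \<in> carrier A" if "b \<in> ?P" "c \<in> ?Q" for b c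
    using that sub by auto
  ultimately show ?thesis by (auto simp: bij_betw_def)
qed

text \<open>Sylow subgroups bound both orders from below, and the bijection above fixes their
  product, so both bounds are attained.\<close>

lemma order_primary_components:
  "order (primary_component A p) = p ^ k" "order (primary_component A q) = q ^ l"
proof -
  let ?P = "carrier (primary_component A p)" and ?Q = "carrier (primary_component A q)"
  have pos: "p ^ k > 0" "q ^ l > 0" using p q by (simp_all add: prime_gt_0_nat)
  then have fin: "finite (carrier A)"
    using order unfolding order_def by (metis card.infinite less_numeral_extra(3) nat_0_less_mult_iff)
  then have fin': "finite ?P" "finite ?Q"
    using primary_component_subset finite_subset by blast+
  obtain H where H: "subgroup H (add_monoid A)" "card H = p ^ k"
    using sylow_thm[of p "add_monoid A" k "q ^ l"] p order fin add.is_group by (auto simp: order_def)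
  obtain K where K: "subgroup K (add_monoid A)" "card K = q ^ l"
    using sylow_thm[of q "add_monoid A" l "p ^ k"] q order fin add.is_group
    by (auto simp: order_def mult.commute)
  have P: "p ^ k \<le> card ?P"
    using primary_component_memI[OF H] H(2) card_mono[OF fin'(1)] by (metis subsetI)
  have Q: "q ^ l \<le> card ?Q"
    using primary_component_memI[OF K] K(2) card_mono[OF fin'(2)] by (metis subsetI)
  have prod: "card ?P * card ?Q = p ^ k * q ^ l"
    using bij_betw_same_card[OF primary_sum_bij] order by (simp add: order_def card_cartesian_product)
  have "card ?P * q ^ l \<le> p ^ k * q ^ l"
    using mult_le_mono2[OF Q, of "card ?P"] prod by simp
  then have "card ?P \<le> p ^ k"
    using pos(2) mult_le_cancel2 by blast
  moreover have "p ^ k * card ?Q \<le> p ^ k * q ^ l"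
    using mult_le_mono1[OF P, of "card ?Q"] prod by simp
  then have "card ?Q \<le> q ^ l"
    using pos(1) mult_le_cancel1 by blast
  ultimately show "order (primary_component A p) = p ^ k" "order (primary_component A q) = q ^ l"
    using P Q by (simp_all add: order_def)
qed

end

text \<open>The circle group of the \<open>q\<close>-component has \<open>q\<close> elements, so the
  action of \<open>c\<close> has period \<open>q\<close> and
  \<open>trivial_hom_of_prime_period\<close> applies to the additive group of the
  \<open>r\<close>-component. It is used with \<open>r\<close> equal to \<open>p\<close> and to
  \<open>q\<close>.\<close>

lemma circle_action_trivial_on_primary_component:
  assumes q: "Factorial_Ring.prime (q :: nat)" and ordQ: "order (primary_component A q) = q"
    and fin: "finite (carrier A)"
    and c: "c \<in> carrier (primary_component A q)" and x: "x \<in> carrier (primary_component A r)"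
    and proper: "\<And>d. d dvd order (primary_component A r) \<Longrightarrow>
      q dvd order (primary_component A r) - d \<Longrightarrow> d = order (primary_component A r)"
  shows "circle_action A c x = x"
proof -
  let ?R = "primary_component A r"
  interpret R: brace ?R by (rule primary_component_brace)
  have sub: "x \<in> carrier A" if "x \<in> carrier (primary_component A n)" for x n
    using that primary_component_subset by blast
  interpret Q: brace "primary_component A q" by (rule primary_component_brace)
  interpret C: group "circle_group (primary_component A q)" by (rule Q.circle_group)
  have "c [^]\<^bsub>circle_group (primary_component A q)\<^esub> q = \<zero>"
    using C.pow_order_eq_1[of c] c ordQ by (simp add: circle_group_def order_def)
  \<comment> \<open>Powers depend only on the operation and the unit, which restricting the carrier
    leaves unchanged.\<close>
  then have pow: "c [^]\<^bsub>circle_group A\<^esub> q = \<zero>"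
    by (simp add: circle_group_def nat_pow_def)
  show ?thesis
  proof (rule R.add.trivial_hom_of_prime_period[OF _ _ _ q])
    show "finite (carrier ?R)"
      using fin primary_component_subset finite_subset by blast
    show "circle_action A c \<in> hom (add_monoid ?R) (add_monoid ?R)"
      using circle_action_primary_component_bij[OF sub[OF c], of r] sub c
      by (auto simp: hom_def circle_action_add bij_betw_def)
    show "(circle_action A c ^^ q) y = y" if "y \<in> carrier ?R" for y
      using circle_action_pow[of c y q] pow that sub c by (simp add: circle_action_zero_left)
  qed (use proper x in \<open>auto simp: order_def\<close>)
qed

end

section \<open>The semidirect decomposition\<close>

text \<open>Addition maps the semidirect product to \<open>A\<close>, but an isomorphism out of
  \<open>A\<close> is wanted. Only closure of \<open>B\<close> is assumed, so the product need not
  first be shown to be a brace.\<close>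

lemma isomorphic_braces_sym:
  assumes B: "\<And>x y. x \<in> carrier B \<Longrightarrow> y \<in> carrier B \<Longrightarrow>
      x \<oplus>\<^bsub>B\<^esub> y \<in> carrier B \<and> x \<otimes>\<^bsub>B\<^esub> y \<in> carrier B"
    and iso: "isomorphic_braces B C"
  shows "isomorphic_braces C B"
proof -
  obtain h where h: "h \<in> hom (add_monoid B) (add_monoid C)" "h \<in> hom B C"
    and bij: "bij_betw h (carrier B) (carrier C)"
    using iso by (auto simp: isomorphic_braces_def brace_iso_def brace_hom_def)
  let ?g = "inv_into (carrier B) h"
  have g: "?g y \<in> carrier B" "h (?g y) = y" if "y \<in> carrier C" for y
    using that bij by (auto simp: bij_betw_def inv_into_into f_inv_into_f)
  have gh: "?g (h x) = x" if "x \<in> carrier B" for x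
    using that bij by (auto simp: bij_betw_def)
  have "?g \<in> hom C B"
  proof (rule homI)
    fix x y assume xy: "x \<in> carrier C" "y \<in> carrier C"
    then have "x \<otimes>\<^bsub>C\<^esub> y = h (?g x \<otimes>\<^bsub>B\<^esub> ?g y)"
      using h(2) g by (simp add: hom_mult)
    then show "?g (x \<otimes>\<^bsub>C\<^esub> y) = ?g x \<otimes>\<^bsub>B\<^esub> ?g y"
      using gh B g xy by simp
  qed (use g in auto)
  moreover have "?g \<in> hom (add_monoid C) (add_monoid B)"
  proof (rule homI)
    fix x y assume xy: "x \<in> carrier (add_monoid C)" "y \<in> carrier (add_monoid C)"
    then have "x \<oplus>\<^bsub>C\<^esub> y = h (?g x \<oplus>\<^bsub>B\<^esub> ?g y)"
      using hom_mult[OF h(1)] g by simp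
    then show "?g (x \<otimes>\<^bsub>add_monoid C\<^esub> y) = ?g x \<otimes>\<^bsub>add_monoid B\<^esub> ?g y"
      using gh B g xy by simp
  qed (use g in auto)
  ultimately have "?g \<in> brace_iso C B"
    using bij_betw_inv_into[OF bij] by (simp add: brace_iso_def brace_hom_def)
  then show ?thesis by (auto simp: isomorphic_braces_def)
qed

text \<open>For \<open>d = 1\<close> and \<open>d = p\<close> the difference factors as
  \<open>(p - 1) * (p + 1)\<close> and \<open>p * (p - 1)\<close>. All these factors are positive
  and smaller than \<open>q\<close>; this is where \<open>q > p + 1\<close> enters.\<close>

lemma no_proper_divisor_cong_prime_square:
  fixes p q d :: nat
  assumes p: "Factorial_Ring.prime p" and q: "Factorial_Ring.prime q" and pq: "q > p + 1"
    and d: "d dvd p ^ 2" and qd: "q dvd p ^ 2 - d"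
  shows "d = p ^ 2"
proof -
  have p1: "p > 1" using p by (rule prime_gt_1_nat)
  obtain i where i: "i \<le> 2" "d = p ^ i"
    using d p by (auto simp: divides_primepow_nat)
  have no: "\<not> q dvd p" "\<not> q dvd p - 1" "\<not> q dvd p + 1"
    using p1 pq by (auto dest: dvd_imp_le)
  consider "i = 0" | "i = 1" | "i = 2" using i by linarith
  then show ?thesis
  proof cases
    case 1
    have "p ^ 2 - 1 = (p - 1) * (p + 1)"
      by (simp add: algebra_simps power2_eq_square)
    then have "q dvd (p - 1) * (p + 1)" using 1 i qd by (metis power_0)
    then show ?thesis using no prime_dvd_multD[OF q] by blast
  next
    case 2
    have "p ^ 2 - p = p * (p - 1)"
      by (simp add: algebra_simps power2_eq_square)
    then have "q dvd p * (p - 1)" using 2 i qd by (metis power_one_right)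
    then show ?thesis using no prime_dvd_multD[OF q] by blast
  qed (use i in simp)
qed

text \<open>Addition respects products because the second component of a left factor has no effect,
  as \<open>left\<close> shows; left distributivity does the rest.\<close>

lemma (in brace) isomorphic_semidirect_product:
  assumes bij: "bij_betw (\<lambda>(b, c). b \<oplus> c)
      (carrier (primary_component A p) \<times> carrier (primary_component A q)) (carrier A)"
    and trivial: "\<And>c x. c \<in> carrier (primary_component A q) \<Longrightarrow> x \<in> carrier A \<Longrightarrow>
      circle_action A c x = x"
  shows "isomorphic_braces A
    (semidirect_product (primary_component A p) (primary_component A q) (\<otimes>))"
proof -
  let ?P = "primary_component A p" and ?Q = "primary_component A q"
  let ?S = "semidirect_product ?P ?Q (\<otimes>)" and ?h = "\<lambda>(b, c). b \<oplus> c"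
  have sub: "x \<in> carrier A" if "x \<in> carrier (primary_component A n)" for x n
    using that primary_component_subset by blast
  interpret P: brace ?P by (rule primary_component_brace)
  interpret Q: brace ?Q by (rule primary_component_brace)
  have carrier: "carrier ?S = carrier ?P \<times> carrier ?Q"
    and add: "(b, c) \<oplus>\<^bsub>?S\<^esub> (b', c') = (b \<oplus> b', c \<oplus> c')"
    and mult: "(b, c) \<otimes>\<^bsub>?S\<^esub> (b', c') = (b \<otimes> b', b \<otimes> c')" for b c b' c'
    by (simp_all add: semidirect_product_def RDirProd_def DirProd_def monoid.defs)
  have left: "(b \<oplus> c) \<otimes> y = b \<otimes> y"
    if b: "b \<in> carrier ?P" and c: "c \<in> carrier ?Q" and y: "y \<in> carrier A" for b c y
  proof -
    \<comment> \<open>With this preimage, \<open>b \<oplus> c\<close> is the circle product of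
      \<open>b\<close> and \<open>c'\<close>, and \<open>c'\<close> acts trivially.\<close>
    obtain c' where c': "c' \<in> carrier ?Q" "circle_action A b c' = c"
      using circle_action_primary_component_bij[OF sub[OF b], of q] c
      unfolding bij_betw_def by (metis imageE)
    have "circle_action A (b \<oplus> c) y = circle_action A b y"
      using circle_eq[of b c'] circle_action_circle[of b c' y] c' trivial b c y sub by simp
    then show ?thesis
      using b c y sub by (simp add: circle_action_def mult_closed)
  qed
  have "?h \<in> hom ?S A"
  proof (rule homI)
    fix x y assume "x \<in> carrier ?S" "y \<in> carrier ?S"
    then obtain b c b' c' where xy: "x = (b, c)" "y = (b', c')"
      and mem: "b \<in> carrier ?P" "b' \<in> carrier ?P" "c \<in> carrier ?Q" "c' \<in> carrier ?Q"
      using carrier by auto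
    then show "?h (x \<otimes>\<^bsub>?S\<^esub> y) = ?h x \<otimes> ?h y"
      using left sub by (simp add: mult left_distrib)
  qed (use carrier sub in auto)
  moreover have "?h \<in> hom (add_monoid ?S) (add_monoid A)"
  proof (rule homI)
    fix x y assume "x \<in> carrier (add_monoid ?S)" "y \<in> carrier (add_monoid ?S)"
    then obtain b c b' c' where xy: "x = (b, c)" "y = (b', c')"
      and mem: "b \<in> carrier ?P" "b' \<in> carrier ?P" "c \<in> carrier ?Q" "c' \<in> carrier ?Q"
      using carrier by auto
    then show "?h (x \<otimes>\<^bsub>add_monoid ?S\<^esub> y) = ?h x \<otimes>\<^bsub>add_monoid A\<^esub> ?h y"
      using sub by (simp add: add a_ac)
  qed (use carrier sub in auto)
  ultimately have "isomorphic_braces ?S A"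
    using bij carrier by (auto simp: isomorphic_braces_def brace_iso_def brace_hom_def)
  moreover have "x \<oplus>\<^bsub>?S\<^esub> y \<in> carrier ?S \<and> x \<otimes>\<^bsub>?S\<^esub> y \<in> carrier ?S"
    if "x \<in> carrier ?S" "y \<in> carrier ?S" for x y
    using that P.a_closed Q.a_closed sub
    by (auto simp: carrier add mult mult_primary_component)
  ultimately show ?thesis by (rule isomorphic_braces_sym[rotated])
qed

theorem theorem2:
  fixes A :: "('a, 'm) ring_scheme" and p q :: nat
  assumes "brace A"
    and "Factorial_Ring.prime p" and "Factorial_Ring.prime q" and "q > p + 1"
    and "order A = p ^ 2 * q"
  shows "\<exists>act. brace_module (primary_component A p) (primary_component A q) act \<and>
    isomorphic_braces A
      (semidirect_product (primary_component A p) (primary_component A q) act)"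
proof -
  interpret brace A by fact
  let ?P = "primary_component A p" and ?Q = "primary_component A q"
  have pq: "p \<noteq> q" and order: "order A = p ^ 2 * q ^ 1" using assms by auto
  note bij = primary_sum_bij[OF assms(2,3) pq order]
  note ord = order_primary_components[OF assms(2,3) pq order]
  have "order A > 0" using assms by (simp add: prime_gt_0_nat)
  then have fin: "finite (carrier A)" by (simp add: order_def card_gt_0_iff)
  \<comment> \<open>The action is additive, so it is enough to treat the two components of
    \<open>x\<close> separately, each with its own divisor condition.\<close>
  have trivial: "circle_action A c x = x" if c: "c \<in> carrier ?Q" and x: "x \<in> carrier A" for c x
  proof -
    have sub: "y \<in> carrier A" if "y \<in> carrier (primary_component A n)" for y n
      using that primary_component_subset by blast
    obtain b d where bd: "b \<in> carrier ?P" "d \<in> carrier ?Q" "x = b \<oplus>\<^bsub>A\<^esub> d"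
      using bij x unfolding bij_betw_def by force
    have "circle_action A c b = b"
      using no_proper_divisor_cong_prime_square[OF assms(2-4)] ord
      by (intro circle_action_trivial_on_primary_component[OF assms(3) _ fin c bd(1)]) auto
    moreover have "e = q" if "e dvd q" "q dvd q - e" for e
    proof -
      have "e = 1 \<or> e = q" using \<open>e dvd q\<close> assms(3) by (auto simp: prime_nat_iff)
      moreover have "\<not> q dvd q - 1"
        using prime_gt_1_nat[OF assms(3)] by (auto dest: dvd_imp_le)
      ultimately show ?thesis using \<open>q dvd q - e\<close> by blast
    qed
    then have "circle_action A c d = d"
      using ord
      by (intro circle_action_trivial_on_primary_component[OF assms(3) _ fin c bd(2)]) auto
    ultimately show ?thesis using bd c sub by (simp add: circle_action_add)
  qed
  \<comment> \<open>The witness for \<open>act\<close> is the multiplication of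
    \<open>A\<close>.\<close>
  show ?thesis
    using primary_component_module isomorphic_semidirect_product[OF bij trivial] by blast
qed

end
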